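(* Let $k_4$ be the morphism $\texttt{0}\mapsto\texttt{1232}$, $\texttt{1}\mapsto\texttt{12}$, $\texttt{2}\mapsto\texttt{10}$ and $k_3$ the morphism $\texttt{0}\mapsto\texttt{122}$, $\texttt{1}\mapsto\texttt{12}$, $\texttt{2}\mapsto\texttt{10}$. Then: (1) every bi-infinite overlap-free walk on $P_4$ has the same set of finite factors as $k_4(b_3)$; (2) every bi-infinite overlap-free walk on $P_3^\star$ has the same set of finite factors as $k_3(b_3)$.
   Context: $P_4$ is the undirected path with vertices $\texttt{0},\texttt{1},\texttt{2},\texttt{3}$ and edges $\texttt{01},\texttt{12},\texttt{23}$. $P_3^\star$ is the undirected path with vertices $\texttt{0},\texttt{1},\texttt{2}$ and edges $\texttt{01},\texttt{12}$, together with a loop at $\texttt{2}$. A walk on a graph is a word over its vertex set in which any two consecutive letters are joined by an edge (or loop). A word is overlap-free if it contains no factor $u^nv$ with $u$ nonempty, $v$ a prefix of $u$, and exponent $|u^nv|/|u|>2$. $b_3$ is the Hall–Thue word, the fixed point starting with $\texttt{0}$ of the morphism $\texttt{0}\mapsto\texttt{012}$, $\texttt{1}\mapsto\texttt{02}$, $\texttt{2}\mapsto\texttt{1}$. *)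

theory Defs
  imports Complex_Main "HOL-Library.Sublist"
begin

text \<open>
  Finite words are lists, right-infinite words are functions on \<open>nat\<close>, and bi-infinite words are
  functions on \<open>int\<close>. Letters are natural numbers.
\<close>

definition factors :: "(nat \<Rightarrow> 'a) \<Rightarrow> 'a list set" where
  "factors x = {map x [i..<j] | i j. True}"

definition bi_factors :: "(int \<Rightarrow> 'a) \<Rightarrow> 'a list set" where
  "bi_factors w = {map w [i..j] | i j. True}"

definition is_overlap :: "'a list \<Rightarrow> bool" where
  "is_overlap x \<longleftrightarrow>
     (\<exists>u n v. u \<noteq> [] \<and> prefix v u \<and> x = concat (replicate n u) @ v \<and>
        real (length x) / real (length u) > 2)"

definition bi_overlap_free :: "(int \<Rightarrow> 'a) \<Rightarrow> bool" where
  "bi_overlap_free w \<longleftrightarrow> \<not> (\<exists>x \<in> bi_factors w. is_overlap x)"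


text \<open>
  An undirected graph is given by its vertex set \<open>V\<close> and its set \<open>E\<close> of edges; an edge is the set of
  its endpoints, so that a loop at \<open>a\<close> is the singleton \<open>{a}\<close>.
\<close>

definition bi_walk :: "'a set \<Rightarrow> 'a set set \<Rightarrow> (int \<Rightarrow> 'a) \<Rightarrow> bool" where
  "bi_walk V E w \<longleftrightarrow> (\<forall>i. w i \<in> V) \<and> (\<forall>i. {w i, w (i + 1)} \<in> E)"

definition P4_verts :: "nat set" where
  "P4_verts = {0, 1, 2, 3}"

definition P4_edges :: "nat set set" where
  "P4_edges = {{0, 1}, {1, 2}, {2, 3}}"

definition P3_star_verts :: "nat set" where
  "P3_star_verts = {0, 1, 2}"

definition P3_star_edges :: "nat set set" where
  "P3_star_edges = {{0, 1}, {1, 2}, {2}}"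


text \<open>
  A morphism is given by the images of the letters; \<open>word_image f\<close> is its extension to finite words.
  For a morphism that erases no letter of \<open>x\<close>, the first \<open>i + 1\<close> letters of \<open>x\<close> already
  determine the letter at position \<open>i\<close> of the image of \<open>x\<close>; \<open>inf_image\<close> is meant for such
  morphisms only, and \<open>inf_image_prefix\<close> below shows that it is then the extension to infinite words.
\<close>

definition word_image :: "('a \<Rightarrow> 'b list) \<Rightarrow> 'a list \<Rightarrow> 'b list" where
  "word_image f xs = concat (map f xs)"

definition inf_image :: "('a \<Rightarrow> 'b list) \<Rightarrow> (nat \<Rightarrow> 'a) \<Rightarrow> nat \<Rightarrow> 'b" where
  "inf_image f x i = word_image f (map x [0..<Suc i]) ! i"

text \<open>The following are morphisms on words over \<open>{0, 1, 2}\<close>; other letters never occur.\<close>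

definition hall_thue :: "nat \<Rightarrow> nat list" where
  "hall_thue a =
     (if a = 0 then [0, 1, 2] else if a = 1 then [0, 2] else if a = 2 then [1] else [])"

definition k4 :: "nat \<Rightarrow> nat list" where
  "k4 a = (if a = 0 then [1, 2, 3, 2] else if a = 1 then [1, 2] else if a = 2 then [1, 0] else [])"

definition k3 :: "nat \<Rightarrow> nat list" where
  "k3 a = (if a = 0 then [1, 2, 2] else if a = 1 then [1, 2] else if a = 2 then [1, 0] else [])"

text \<open>Existence and uniqueness of the fixed point are proved in \<open>ex1_b3\<close> below.\<close>

definition b3 :: "nat \<Rightarrow> nat" where
  "b3 = (THE x. range x \<subseteq> {0, 1, 2} \<and> x 0 = 0 \<and> inf_image hall_thue x = x)"


lemma word_image_Nil [simp]: "word_image f [] = []"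
  and word_image_Cons [simp]: "word_image f (a # xs) = f a @ word_image f xs"
  and word_image_append [simp]: "word_image f (xs @ ys) = word_image f xs @ word_image f ys"
  by (simp_all add: word_image_def)

lemma word_image_mono_prefix: "prefix xs ys \<Longrightarrow> prefix (word_image f xs) (word_image f ys)"
  by (auto simp: prefix_def)

lemma prefix_nth: "prefix xs ys \<Longrightarrow> i < length xs \<Longrightarrow> ys ! i = xs ! i"
  by (auto simp: prefix_def nth_append)

lemma length_word_image_ge:
  assumes "\<And>a. a \<in> set xs \<Longrightarrow> f a \<noteq> []"
  shows "length xs \<le> length (word_image f xs)"
  using assms
proof (induction xs)
  case (Cons a xs)
  have "f a \<noteq> []" "length xs \<le> length (word_image f xs)"
    using Cons by auto
  then show ?case
    by (cases "f a") auto
qed simp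

lemma prefix_map_upt: "m \<le> n \<Longrightarrow> prefix (map x [0..<m]) (map x [0..<n])"
  by (metis le_add_diff_inverse map_append prefixI upt_add_eq_append zero_le)

lemma inf_image_prefix:
  assumes nonerasing: "\<And>i. f (x i) \<noteq> []"
  shows "map (inf_image f x) [0..<length (word_image f (map x [0..<n]))] =
           word_image f (map x [0..<n])"
proof (rule nth_equalityI)
  fix i
  let ?u = "word_image f (map x [0..<n])" and ?v = "word_image f (map x [0..<Suc i])"
  assume "i < length (map (inf_image f x) [0..<length ?u])"
  then have i: "i < length ?u"
    by simp
  have "length (map x [0..<Suc i]) \<le> length ?v"
    by (rule length_word_image_ge) (use nonerasing in auto)
  then have i': "i < length ?v"
    by simp
  have "prefix ?u ?v \<or> prefix ?v ?u"
    by (metis nle_le prefix_map_upt word_image_mono_prefix)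
  then have "?v ! i = ?u ! i"
    using i i' prefix_nth by metis
  then show "map (inf_image f x) [0..<length ?u] ! i = ?u ! i"
    using i by (simp add: inf_image_def)
qed simp

lemma hall_thue_nonempty: "a \<in> {0, 1, 2} \<Longrightarrow> hall_thue a \<noteq> []"
  by (auto simp: hall_thue_def)

lemma length_hall_thue_gt:
  assumes "set xs \<subseteq> {0, 1, 2}" "xs \<noteq> []" "hd xs = 0"
  shows "length xs < length (word_image hall_thue xs)"
proof -
  obtain ys where xs: "xs = 0 # ys"
    using assms by (cases xs) auto
  have "length ys \<le> length (word_image hall_thue ys)"
    by (rule length_word_image_ge) (use assms xs hall_thue_nonempty in auto)
  then show ?thesis
    by (simp add: xs hall_thue_def)
qed

lemma ex1_b3: "\<exists>!x. range x \<subseteq> {0, 1, 2} \<and> x 0 = 0 \<and> inf_image hall_thue x = x"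
proof -
  define P where "P n = (word_image hall_thue ^^ n) [0]" for n
  have P_Suc: "P (Suc n) = word_image hall_thue (P n)" for n
    by (simp add: P_def)
  have P_0: "P 0 = [0]"
    by (simp add: P_def)
  have step: "prefix (P n) (P (Suc n))" for n
  proof (induction n)
    case 0
    show ?case by (simp add: P_Suc P_0 hall_thue_def)
  next
    case (Suc n)
    then show ?case by (metis P_Suc word_image_mono_prefix)
  qed
  have mono: "prefix (P m) (P n)" if "m \<le> n" for m n
    using that by (induction rule: dec_induct) (auto intro: prefix_order.trans step)
  have P_set: "set (P n) \<subseteq> {0, 1, 2}" for n
    by (induction n) (auto simp: P_0 P_Suc word_image_def hall_thue_def split: if_splits)
  have P_hd: "P n \<noteq> [] \<and> hd (P n) = 0" for n
    using mono[of 0 n] by (auto simp: P_0 prefix_def)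
  have P_length: "n < length (P n)" for n
  proof (induction n)
    case (Suc n)
    then show ?case
      using length_hall_thue_gt[OF P_set, of n] P_hd[of n] by (simp add: P_Suc)
  qed (simp add: P_0)
  define b where "b i = P i ! i" for i
  have b_nth: "P n ! i = b i" if "i < length (P n)" for n i
    unfolding b_def using that P_length[of i] mono[of n i] mono[of i n] prefix_nth
    by (metis nle_le)
  have b_range: "range b \<subseteq> {0, 1, 2}"
  proof (rule image_subsetI)
    show "b i \<in> {0, 1, 2}" for i
      using subsetD[OF P_set nth_mem[OF P_length]] unfolding b_def .
  qed
  have b_0: "b 0 = 0"
    by (simp add: b_def P_0)
  have b_fix: "inf_image hall_thue b = b"
  proof
    fix i
    let ?u = "map b [0..<Suc i]"
    have "?u = take (Suc i) (P (Suc i))"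
      using P_length[of "Suc i"] by (intro nth_equalityI) (auto simp: b_nth simp del: upt_Suc)
    then have pre: "prefix (word_image hall_thue ?u) (P (Suc (Suc i)))"
      by (metis P_Suc take_is_prefix word_image_mono_prefix)
    have "length ?u \<le> length (word_image hall_thue ?u)"
      by (rule length_word_image_ge) (use b_range hall_thue_nonempty in auto)
    then have "i < length (word_image hall_thue ?u)"
      by simp
    then have "word_image hall_thue ?u ! i = P (Suc (Suc i)) ! i"
      using prefix_nth[OF pre] by simp
    also have "\<dots> = b i"
      using P_length[of "Suc (Suc i)"] by (intro b_nth) simp
    finally show "inf_image hall_thue b i = b i"
      by (simp only: inf_image_def)
  qed
  have rec: "x i = word_image hall_thue (map x [0..<i]) ! i"
    if "range x \<subseteq> {0, 1, 2}" "x 0 = 0" "inf_image hall_thue x = x" "i > 0" for x i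
  proof -
    have "length (map x [0..<i]) < length (word_image hall_thue (map x [0..<i]))"
    proof (rule length_hall_thue_gt)
      show "set (map x [0..<i]) \<subseteq> {0, 1, 2}"
        using that(1) by (simp add: image_subset_iff)
    qed (use that in \<open>simp_all add: hd_map\<close>)
    then have "word_image hall_thue (map x [0..<Suc i]) ! i = word_image hall_thue (map x [0..<i]) ! i"
      by (simp add: nth_append)
    then show ?thesis
      using fun_cong[OF that(3), of i] by (simp only: inf_image_def)
  qed
  have unique: "x = b" if x: "range x \<subseteq> {0, 1, 2}" "x 0 = 0" "inf_image hall_thue x = x" for x
  proof
    fix i
    show "x i = b i"
    proof (induction i rule: less_induct)
      case (less i)
      show ?case
      proof (cases "i = 0")
        case False
        then have "map x [0..<i] = map b [0..<i]"
          using less by simp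
        then show ?thesis
          using rec[OF x, of i] rec[OF b_range b_0 b_fix, of i] False by (metis gr0I)
      qed (simp add: x b_0)
    qed
  qed
  show ?thesis
    by (rule ex1I[of _ b]) (simp_all only: b_range b_0 b_fix unique simp_thms)
qed

lemma b3_range: "range b3 \<subseteq> {0, 1, 2}"
  and b3_0: "b3 0 = 0"
  and b3_fixed_point: "inf_image hall_thue b3 = b3"
  using theI'[OF ex1_b3, folded b3_def] by simp_all

end

theory Submission
  imports Defs
begin

text \<open>
  Cutting an overlap-free walk before each occurrence of \<open>1\<close> leaves only the blocks \<open>k 0\<close>, \<open>k 1\<close>,
  \<open>k 2\<close>, so the walk is \<open>k(x)\<close> for a bi-infinite word \<open>x\<close>. As every block starts with \<open>1\<close>, a square
  in \<open>x\<close> gives an overlap; and \<open>k(010)\<close> contains the overlap \<open>21212\<close>, while \<open>212\<close> extends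
  to \<open>02120\<close>, whose image contains the overlap \<open>210121012\<close>. So \<open>x\<close> is square-free and avoids
  \<open>010\<close> and \<open>212\<close>. Cutting such a word before each \<open>0\<close> shows that it is the image under the
  Hall--Thue morphism \<open>h\<close> of a word of the same kind. Iterating, each factor of \<open>x\<close> lies in some
  \<open>h\<^sup>n(ab)\<close> with \<open>a \<noteq> b\<close>, and all six words \<open>ab\<close> occur in \<open>b\<^sub>3\<close>; conversely
  \<open>h\<^sup>n(0)\<close> occurs in \<open>x\<close> for all \<open>n\<close>.

  Bi-infinite words are only used through their sets of factors, that is, through
  factor-closed languages whose words can be extended on both sides.
\<close>

section \<open>Factors of infinite words\<close>

lemma map_upt_sublist:
  assumes "sublist v (map x [i..<j])"
  shows "v \<in> factors x"
proof -
  obtain p q where pq: "map x [i..<j] = p @ v @ q"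
    using assms by (auto simp: sublist_def)
  then have len: "j - i = length p + length v + length q"
    by (metis add.assoc length_append length_map length_upt)
  have "v = map x [i + length p..<i + length p + length v]"
  proof (rule nth_equalityI)
    fix k assume "k < length v"
    then have "v ! k = map x [i..<j] ! (length p + k)"
      by (simp add: pq nth_append)
    then show "v ! k = map x [i + length p..<i + length p + length v] ! k"
      using \<open>k < length v\<close> len by (simp add: add.assoc)
  qed simp
  then show ?thesis
    by (auto simp: factors_def)
qed

lemma factors_sublist: "u \<in> factors x \<Longrightarrow> sublist v u \<Longrightarrow> v \<in> factors x"
  using map_upt_sublist[of v x] unfolding factors_def[of x] by blast

text \<open>A nonerasing morphism maps the first \<open>j\<close> letters of \<open>x\<close> to at
  least \<open>j\<close> letters, so a factor of the image ending at position \<open>j\<close> lies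
  in the image of that prefix. Conversely, the image of a factor sits inside the image of a prefix,
  which is a prefix of the infinite image.\<close>

lemma factors_inf_image:
  assumes nonerasing: "\<And>i. f (x i) \<noteq> []"
  shows "factors (inf_image f x) = {v. \<exists>u\<in>factors x. sublist v (word_image f u)}"
proof (intro equalityI subsetI)
  fix v assume "v \<in> factors (inf_image f x)"
  then obtain i j where v: "v = map (inf_image f x) [i..<j]"
    by (auto simp: factors_def)
  let ?u = "map x [0..<j]"
  have "j \<le> length (word_image f ?u)"
    using length_word_image_ge[of ?u f] nonerasing by auto
  then have "prefix (map (inf_image f x) [0..<j]) (word_image f ?u)"
    using prefix_map_upt inf_image_prefix[of f x j, OF nonerasing] by metis
  moreover have "sublist v (map (inf_image f x) [0..<j])"
  proof (cases "i \<le> j")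
    case True
    then have "[0..<j] = [0..<i] @ [i..<j]"
      using upt_add_eq_append[of 0 i "j - i"] by simp
    then show ?thesis
      by (simp add: v)
  qed (simp add: v)
  ultimately have "sublist v (word_image f ?u)"
    using prefix_imp_sublist sublist_order.order.trans by blast
  then show "v \<in> {v. \<exists>u\<in>factors x. sublist v (word_image f u)}"
    by (auto simp: factors_def)
next
  fix v assume "v \<in> {v. \<exists>u\<in>factors x. sublist v (word_image f u)}"
  then obtain i j where v: "sublist v (word_image f (map x [i..<j]))"
    by (auto simp: factors_def)
  have "sublist (word_image f (map x [i..<j])) (word_image f (map x [0..<j]))"
  proof (cases "i \<le> j")
    case True
    then have "[0..<j] = [0..<i] @ [i..<j]"
      using upt_add_eq_append[of 0 i "j - i"] by simp
    then show ?thesis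
      by simp
  qed simp
  then have "sublist v (map (inf_image f x) [0..<length (word_image f (map x [0..<j]))])"
    using v inf_image_prefix[of f x j, OF nonerasing] sublist_order.order.trans by metis
  then show "v \<in> factors (inf_image f x)"
    by (rule map_upt_sublist)
qed

section \<open>Factors of bi-infinite words\<close>

lemma bi_factors_sublist:
  assumes "u \<in> bi_factors w" "sublist v u"
  shows "v \<in> bi_factors w"
proof -
  obtain i j p q where pq: "map w [i..j] = p @ v @ q"
    using assms by (auto simp: bi_factors_def sublist_def)
  then have len: "nat (j - i + 1) = length p + length v + length q"
    by (metis add.assoc length_append length_map length_upto)
  have "v = map w [i + int (length p)..i + int (length p) + int (length v) - 1]"
  proof (rule nth_equalityI)
    fix k assume "k < length v"
    then have "v ! k = map w [i..j] ! (length p + k)"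
      by (simp add: pq nth_append)
    then show "v ! k = map w [i + int (length p)..i + int (length p) + int (length v) - 1] ! k"
      using \<open>k < length v\<close> len by (simp add: add.assoc nth_upto)
  qed simp
  then show ?thesis
    unfolding bi_factors_def by blast
qed

lemma Nil_in_bi_factors: "[] \<in> bi_factors w"
  unfolding bi_factors_def by (rule CollectI, rule exI[of _ 1], rule exI[of _ 0]) simp

lemma bi_factors_extend:
  assumes "u \<in> bi_factors w"
  shows "\<exists>a b. a # u @ [b] \<in> bi_factors w"
proof -
  obtain i j where u: "u = map w [i..j]"
    using assms by (auto simp: bi_factors_def)
  \<comment> \<open>For the empty word, \<open>i\<close> may lie far to the right of
    \<open>j\<close>. Moving the start to \<open>j + 1\<close> makes the two new letters
    adjacent.\<close>
  define m where "m = (if i \<le> j then i else j + 1)"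
  have "map w [m - 1..j + 1] = w (m - 1) # u @ [w (j + 1)]"
    by (auto simp: m_def u upto_rec1[of "_ - 1"] upto_rec1[of j] upto_rec2[of _ "j + 1"])
  then have "w (m - 1) # u @ [w (j + 1)] \<in> bi_factors w"
    unfolding bi_factors_def by (metis (mono_tags, lifting) mem_Collect_eq)
  then show ?thesis
    by blast
qed

lemma bi_factors_pair: "[a, b] \<in> bi_factors w \<Longrightarrow> \<exists>i. a = w i \<and> b = w (i + 1)"
proof -
  assume "[a, b] \<in> bi_factors w"
  then have "\<exists>i j. [a, b] = map w [i..j]"
    by (simp only: bi_factors_def mem_Collect_eq simp_thms)
  then obtain i j where ij: "map w [i..j] = [a, b]"
    by metis
  then have "length [i..j] = 2"
    by (metis length_map length_Cons list.size(3) numeral_2_eq_2)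
  then have "j = i + 1"
    by simp
  then show ?thesis
    using ij by (auto simp: upto_rec1)
qed

section \<open>Decoding a language\<close>

locale factor_language =
  fixes L :: "'a list set"
  assumes factor: "u \<in> L \<Longrightarrow> sublist v u \<Longrightarrow> v \<in> L"
    and Nil_in: "[] \<in> L"
    and extend: "u \<in> L \<Longrightarrow> \<exists>a b. a # u @ [b] \<in> L"
begin

lemma infix_in: "p @ u @ q \<in> L \<Longrightarrow> u \<in> L"
  using factor by blast

lemma extend_length:
  assumes "u \<in> L"
  shows "\<exists>p q. length p = n \<and> length q = n \<and> p @ u @ q \<in> L"
proof (induction n)
  case 0
  show ?case using assms by simp
next
  case (Suc n)
  then obtain p q where pq: "length p = n" "length q = n" "p @ u @ q \<in> L"
    by blast
  then obtain a b where "a # (p @ u @ q) @ [b] \<in> L"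
    using extend by blast
  then show ?case
    using pq by (intro exI[of _ "a # p"] exI[of _ "q @ [b]"]) simp
qed

lemma marker_free_length:
  assumes recurs: "\<And>u. u \<in> L \<Longrightarrow> length u = N \<Longrightarrow> c \<in> set u"
    and "c \<notin> set s" "p @ s @ q \<in> L"
  shows "length s < N"
proof (rule ccontr)
  assume "\<not> length s < N"
  moreover have "take N s \<in> L"
    using infix_in[of p "take N s" "drop N s @ q"] assms(3)
    by (metis append.assoc append_take_drop_id)
  ultimately show False
    using recurs[of "take N s"] assms(2) by (auto dest: in_set_takeD)
qed

text \<open>Cutting \<open>c # s\<close> before each \<open>c\<close> leaves return words of
  \<open>c\<close>. The induction peels off the first one; the marker that ends it also starts the
  rest, so both pieces lie in \<open>L\<close>.\<close>

lemma parse_by_return_words: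
  assumes return_words:
    "\<And>s. c \<notin> set s \<Longrightarrow> c # s @ [c] \<in> L \<Longrightarrow> \<exists>y. set y \<subseteq> A \<and> c # s = word_image f y"
  shows "c # s @ [c] \<in> L \<Longrightarrow> \<exists>y. set y \<subseteq> A \<and> c # s = word_image f y"
proof (induction s rule: length_induct)
  case (1 s)
  show ?case
  proof (cases "c \<in> set s")
    case True
    then obtain s1 s2 where s: "s = s1 @ c # s2" "c \<notin> set s1"
      by (meson split_list_first)
    have "c # s1 @ [c] \<in> L" "c # s2 @ [c] \<in> L"
      using "1.prems" infix_in[of "[]" "c # s1 @ [c]" "s2 @ [c]"]
        infix_in[of "c # s1" "c # s2 @ [c]" "[]"]
      by (simp_all add: s)
    moreover have "length s2 < length s"
      by (simp add: s)
    ultimately obtain y1 y2 where "set y1 \<subseteq> A" "c # s1 = word_image f y1"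
      "set y2 \<subseteq> A" "c # s2 = word_image f y2"
      using return_words[OF s(2)] "1.IH" by blast
    then show ?thesis
      by (intro exI[of _ "y1 @ y2"]) (simp add: s flip: append_Cons)
  qed (use "1.prems" return_words in blast)
qed

end

lemma factor_language_bi_factors: "factor_language (bi_factors w)"
  by unfold_locales (use bi_factors_sublist Nil_in_bi_factors bi_factors_extend in blast)+

section \<open>Decoding with a recurrent marker letter\<close>

text \<open>\<open>marker\<close> lets every word of \<open>L\<close> be enlarged until it is
  delimited by \<open>c\<close>. \<open>parse\<close> admits coded text between \<open>s\<close> and
  the closing marker because a block need not start with the marker: \<open>hall_thue 2\<close> is
  \<open>[1]\<close>.\<close>

locale decodable_language = factor_language L for L :: "'b list set" +
  fixes f :: "'a \<Rightarrow> 'b list" and A :: "'a set" and c :: 'b and N :: nat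
  assumes marker: "u \<in> L \<Longrightarrow> length u = N \<Longrightarrow> c \<in> set u"
    and parse: "c # s @ word_image f z @ [c] \<in> L \<Longrightarrow> set z \<subseteq> A \<Longrightarrow>
      \<exists>y. set y \<subseteq> A \<and> c # s = word_image f y"
begin

text \<open>The closing marker certifies that the last block ends there, which matters when one
  block is a prefix of another, as \<open>k4 1\<close> is of \<open>k4 0\<close>. The context
  \<open>p\<close>, \<open>q\<close> makes the set closed under factors.\<close>

definition decoded :: "'a list set" where
  "decoded = {u. \<exists>p q. set (p @ u @ q) \<subseteq> A \<and> word_image f (p @ u @ q) @ [c] \<in> L}"

lemma extend_to_marker:
  assumes "u \<in> L"
  shows "\<exists>p q. c # p @ u @ q @ [c] \<in> L"
proof -
  obtain p q where pq: "length p = N" "length q = N" "p @ u @ q \<in> L"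
    using extend_length[OF assms] by blast
  then have "p \<in> L" "q \<in> L"
    using infix_in[of "[]" p "u @ q"] infix_in[of "p @ u" q "[]"] by simp_all
  then obtain p1 p2 q1 q2 where "p = p1 @ c # p2" "q = q1 @ c # q2"
    using marker[OF \<open>p \<in> L\<close>] marker[OF \<open>q \<in> L\<close>] pq split_list[of c p] split_list[of c q] by metis
  then have "c # p2 @ u @ q1 @ [c] \<in> L"
    using pq(3) infix_in[of p1 "c # p2 @ u @ q1 @ [c]" q2] by simp
  then show ?thesis
    by blast
qed

lemma decoded_letters: "u \<in> decoded \<Longrightarrow> set u \<subseteq> A"
  by (auto simp: decoded_def)

lemma decoded_image_marker: "u \<in> decoded \<Longrightarrow> \<exists>q. word_image f (u @ q) @ [c] \<in> L"
proof -
  assume "u \<in> decoded"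
  then obtain p q where "word_image f p @ (word_image f (u @ q) @ [c]) @ [] \<in> L"
    by (auto simp: decoded_def)
  then show ?thesis
    using infix_in by blast
qed

lemma decoded_image: "u \<in> decoded \<Longrightarrow> word_image f u \<in> L"
  using decoded_image_marker[of u] infix_in[of "[]"] by force

lemma decoded_cover: "v \<in> L \<Longrightarrow> \<exists>u\<in>decoded. sublist v (word_image f u)"
proof -
  assume "v \<in> L"
  then obtain p q where pq: "c # p @ v @ q @ [c] \<in> L"
    using extend_to_marker by blast
  then obtain y where y: "set y \<subseteq> A" "c # p @ v @ q = word_image f y"
    using parse[of "p @ v @ q" "[]"] by auto
  have "word_image f y @ [c] \<in> L"
    using pq by (simp flip: y(2))
  then have "y \<in> decoded"
    unfolding decoded_def using y(1) by (intro CollectI exI[of _ "[]"]) simp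
  moreover have "sublist v (word_image f y)"
    by (metis append_Cons sublist_appendI y(2))
  ultimately show ?thesis
    by blast
qed

lemma decoded_language: "L = {v. \<exists>u\<in>decoded. sublist v (word_image f u)}"
  using decoded_cover decoded_image factor by blast

lemma decoded_factor:
  assumes "u \<in> decoded" "sublist v u"
  shows "v \<in> decoded"
proof -
  obtain p q p' q' where "set (p @ u @ q) \<subseteq> A" "word_image f (p @ u @ q) @ [c] \<in> L"
    "u = p' @ v @ q'"
    using assms by (auto simp: decoded_def sublist_def)
  then show ?thesis
    unfolding decoded_def by (intro CollectI exI[of _ "p @ p'"] exI[of _ "q' @ q"]) simp
qed

text \<open>The image with its closing marker is enlarged to a word with a marker at both ends. The
  new text on the left parses in front of the old blocks, and the new text on the right parses from
  the old closing marker. Both pieces contain a marker, hence supply at least one letter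
  each.\<close>

lemma decoded_extend:
  assumes "u \<in> decoded"
  shows "\<exists>a b. a # u @ [b] \<in> decoded"
proof -
  obtain p q where z: "set (p @ u @ q) \<subseteq> A" "word_image f (p @ u @ q) @ [c] \<in> L"
    using assms by (auto simp: decoded_def)
  obtain p' q' where
    L: "c # p' @ (word_image f (p @ u @ q) @ [c]) @ q' @ [c] \<in> L"
    using extend_to_marker[OF z(2)] by blast
  have "c # p' @ word_image f (p @ u @ q) @ [c] \<in> L" "c # q' @ [c] \<in> L"
    using infix_in[of "[]" "c # p' @ word_image f (p @ u @ q) @ [c]" "q' @ [c]"]
      infix_in[of "c # p' @ word_image f (p @ u @ q)" "c # q' @ [c]" "[]"] L
    by simp_all
  then obtain y1 y2 where y: "set y1 \<subseteq> A" "c # p' = word_image f y1"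
    "set y2 \<subseteq> A" "c # q' = word_image f y2"
    using parse[OF _ z(1)] parse[of q' "[]"] by force
  then have "y1 \<noteq> []" "y2 \<noteq> []"
    by auto
  then obtain p2 a b q2 where pq: "y1 @ p = p2 @ [a]" "q @ y2 = b # q2"
    by (metis append_is_Nil_conv neq_Nil_conv rev_exhaust)
  have "word_image f (y1 @ p @ u @ q @ y2) @ [c] \<in> L"
    using L by (simp flip: y(2,4))
  moreover have "y1 @ p @ u @ q @ y2 = p2 @ (a # u @ [b]) @ q2"
    using pq by (metis append.assoc append_Cons append_Nil)
  moreover have "set (y1 @ p @ u @ q @ y2) \<subseteq> A"
    using y z(1) by simp
  ultimately have "a # u @ [b] \<in> decoded"
    unfolding decoded_def by auto
  then show ?thesis
    by blast
qed

lemma factor_language_decoded: "factor_language decoded"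
proof
  show "[] \<in> decoded"
    using decoded_cover[OF Nil_in] decoded_factor by blast
qed (use decoded_factor decoded_extend in blast)+

end

section \<open>Square-free ternary words avoiding 010 and 212\<close>

locale thue_language = factor_language L for L :: "nat list set" +
  assumes letters: "u \<in> L \<Longrightarrow> set u \<subseteq> {0, 1, 2}"
    and square_free: "u \<noteq> [] \<Longrightarrow> u @ u \<notin> L"
    and avoids_010: "[0, 1, 0] \<notin> L"
    and avoids_212: "[2, 1, 2] \<notin> L"
begin

lemma no_square: "u \<noteq> [] \<Longrightarrow> p @ u @ u @ q \<notin> L"
  using square_free[of u] infix_in[of p "u @ u" q] by auto

lemma no_010: "p @ [0, 1, 0] @ q \<notin> L"
  using avoids_010 infix_in by blast

lemma no_212: "p @ [2, 1, 2] @ q \<notin> L"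
  using avoids_212 infix_in by blast

text \<open>Without \<open>0\<close>, a square-free word alternates between \<open>1\<close> and
  \<open>2\<close>, and four alternating letters form a square.\<close>

lemma zero_recurs:
  assumes "u \<in> L" "length u = 4"
  shows "0 \<in> set u"
proof (rule ccontr)
  assume 0: "0 \<notin> set u"
  obtain a b c d where u: "u = [a, b, c, d]"
    using assms(2) by (auto simp: numeral_eq_Suc length_Suc_conv)
  have "a \<noteq> b" "b \<noteq> c" "c \<noteq> d"
    using assms(1) no_square[of "[a]" "[]" "[c, d]"] no_square[of "[b]" "[a]" "[d]"]
      no_square[of "[c]" "[a, b]" "[]"] by (auto simp: u)
  then have "c = a" "d = b"
    using letters[OF assms(1)] 0 by (auto simp: u)
  then show False
    using assms(1) no_square[of "[a, b]" "[]" "[]"] by (simp add: u)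
qed

text \<open>The square-free candidates for \<open>s\<close> over \<open>1\<close> and
  \<open>2\<close> are the empty word, 1, 2, 12, 21, 121 and 212. The empty word gives 00, and 1
  gives 010; 212 is forbidden. The others give 02 = h(1), 012 = h(0), 021 = h(12) and 0121 = h(02),
  where h is \<open>hall_thue\<close>.\<close>

lemma zero_return_words:
  assumes "0 \<notin> set s" "0 # s @ [0] \<in> L"
  shows "\<exists>y. set y \<subseteq> {0, 1, 2} \<and> 0 # s = word_image hall_thue y"
proof -
  have "length s < 4"
    using marker_free_length[of 4 0 s "[0]" "[0]"] zero_recurs assms by simp
  have s: "set s \<subseteq> {1, 2}"
    using letters[OF assms(2)] assms(1) by auto
  consider "s = []" | a where "s = [a]" | a b where "s = [a, b]"
    | a b c where "s = [a, b, c]"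
    using \<open>length s < 4\<close> by (auto simp: less_Suc_eq numeral_eq_Suc length_Suc_conv)
  then show ?thesis
  proof cases
    case 1
    then show ?thesis
      using assms(2) no_square[of "[0]" "[]" "[]"] by simp
  next
    case (2 a)
    then have "a = 2"
      using s assms(2) no_010[of "[]" "[]"] by auto
    then show ?thesis
      using 2 by (intro exI[of _ "[1]"]) (simp add: hall_thue_def)
  next
    case (3 a b)
    then have "a \<noteq> b"
      using assms(2) no_square[of "[a]" "[0]" "[0]"] by auto
    then consider "a = 1" "b = 2" | "a = 2" "b = 1"
      using 3 s by auto
    then show ?thesis
    proof cases
      case 1
      then show ?thesis
        using 3 by (intro exI[of _ "[0]"]) (simp add: hall_thue_def)
    next
      case 2
      then show ?thesis
        using 3 by (intro exI[of _ "[1, 2]"]) (simp add: hall_thue_def)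
    qed
  next
    case (4 a b c)
    then have "a \<noteq> b" "b \<noteq> c"
      using assms(2) no_square[of "[a]" "[0]" "[c, 0]"] no_square[of "[b]" "[0, a]" "[0]"]
      by auto
    then have "a = 1" "b = 2" "c = 1"
      using 4 s assms(2) no_212[of "[0]" "[0]"] by auto
    then show ?thesis
      using 4 by (intro exI[of _ "[0, 2]"]) (simp add: hall_thue_def)
  qed
qed

lemma hall_thue_parse:
  assumes L: "0 # s @ word_image hall_thue z @ [0] \<in> L" and z: "set z \<subseteq> {0, 1, 2}"
  shows "\<exists>y. set y \<subseteq> {0, 1, 2} \<and> 0 # s = word_image hall_thue y"
proof -
  note parse = parse_by_return_words[OF zero_return_words]
  have starts: "(\<exists>r. word_image hall_thue z @ [0] = 0 # r) \<or> (\<exists>z'. z = 2 # z')"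
    if "set z \<subseteq> {0, 1, 2}" for z
    using that by (cases z) (auto simp: hall_thue_def)
  show ?thesis
  proof (cases "\<exists>r. word_image hall_thue z @ [0] = 0 # r")
    case True
    then obtain r where "word_image hall_thue z @ [0] = 0 # r"
      by blast
    then show ?thesis
      using L infix_in[of "[]" "0 # s @ [0]" r] parse[of s] by simp
  next
    case False
    then obtain z' where z': "z = 2 # z'"
      using starts[OF z] by blast
    have "\<nexists>z''. z' = 2 # z''"
      using L no_square[of "[1]" "0 # s"] by (auto simp: z' hall_thue_def)
    then obtain r where "word_image hall_thue z' @ [0] = 0 # r"
      using starts[of z'] z z' by auto
    then have "0 # (s @ [1]) @ [0] \<in> L"
      using L infix_in[of "[]" "0 # (s @ [1]) @ [0]" r] by (simp add: z' hall_thue_def)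
    then obtain y where y: "set y \<subseteq> {0, 1, 2}" "0 # s @ [1] = word_image hall_thue y"
      using parse by blast
    then obtain y' a where y': "y = y' @ [a]"
      by (cases y rule: rev_exhaust) auto
    have "a = 2"
      using y by (auto simp: y' hall_thue_def split: if_splits)
    then have "0 # s = word_image hall_thue y'"
      using y(2) by (auto simp: y' hall_thue_def simp flip: append_Cons)
    then show ?thesis
      using y(1) y' by auto
  qed
qed

sublocale decodable_language L hall_thue "{0, 1, 2}" 0 4
  by unfold_locales (use zero_recurs hall_thue_parse in blast)+

lemma decoded_square_free:
  assumes "u \<noteq> []"
  shows "u @ u \<notin> decoded"
proof
  assume uu: "u @ u \<in> decoded"
  have "length u \<le> length (word_image hall_thue u)"
    using decoded_letters[OF uu] hall_thue_nonempty by (intro length_word_image_ge) auto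
  then show False
    using decoded_image[OF uu] square_free[of "word_image hall_thue u"] assms
    by (cases "word_image hall_thue u = []") auto
qed

text \<open>The image of 010 is 01.20.20.12, which contains a square. Next to 212, a letter 1 or 2
  would create 22, 1212 or 2121, so 212 extends to 02120, whose image 01.210.210.12 again contains a
  square.\<close>

lemma thue_language_decoded: "thue_language decoded"
proof -
  interpret D: factor_language decoded
    by (rule factor_language_decoded)
  have no_square': "p @ u @ u @ q \<notin> decoded" if "u \<noteq> []" for p u q
    using decoded_square_free[OF that] D.infix_in[of p "u @ u" q] by auto
  show ?thesis
  proof
    show "u \<in> decoded \<Longrightarrow> set u \<subseteq> {0, 1, 2}" for u
      by (rule decoded_letters)
    show "u \<noteq> [] \<Longrightarrow> u @ u \<notin> decoded" for u
      by (rule decoded_square_free)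
    show "[0, 1, 0] \<notin> decoded"
    proof
      assume "[0, 1, 0] \<in> decoded"
      then have "[0, 1, 2, 0, 2, 0, 1, 2] \<in> L"
        using decoded_image by (fastforce simp: hall_thue_def)
      then show False
        using no_square[of "[2, 0]" "[0, 1]" "[1, 2]"] by simp
    qed
    show "[2, 1, 2] \<notin> decoded"
    proof
      assume "[2, 1, 2] \<in> decoded"
      then obtain a b where ab: "a # [2, 1, 2] @ [b] \<in> decoded"
        using D.extend by blast
      then have "a \<noteq> 2" "a \<noteq> 1" "b \<noteq> 2" "b \<noteq> 1"
        using no_square'[of "[2]" "[]" "[1, 2, b]"] no_square'[of "[1, 2]" "[]" "[b]"]
          no_square'[of "[2]" "[a, 2, 1]" "[]"] no_square'[of "[2, 1]" "[a]" "[]"]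
        by auto
      then have "a = 0" "b = 0"
        using decoded_letters[OF ab] by auto
      then have "[0, 1, 2, 1, 0, 2, 1, 0, 1, 2] \<in> L"
        using decoded_image[OF ab] by (simp add: hall_thue_def)
      then show False
        using no_square[of "[2, 1, 0]" "[0, 1]" "[1, 2]"] by simp
    qed
  qed
qed

end

section \<open>Uniqueness of the Thue language\<close>

abbreviation (input) hall_thue_pow :: "nat \<Rightarrow> nat list \<Rightarrow> nat list" where
  "hall_thue_pow n \<equiv> word_image hall_thue ^^ n"

lemma hall_thue_b3_nonempty: "hall_thue (b3 i) \<noteq> []"
  using b3_range hall_thue_nonempty by blast

lemma factors_b3: "factors b3 = {v. \<exists>u\<in>factors b3. sublist v (word_image hall_thue u)}"
  using factors_inf_image[of hall_thue b3, OF hall_thue_b3_nonempty]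
  by (simp add: b3_fixed_point)

lemma hall_thue_pow_factors_b3: "u \<in> factors b3 \<Longrightarrow> hall_thue_pow n u \<in> factors b3"
proof (induction n)
  case (Suc n)
  then show ?case
    using factors_b3 by auto
qed simp

lemma hall_thue_pow_prefix_b3: "\<exists>m>n. hall_thue_pow n [0] = map b3 [0..<m]"
proof (induction n)
  case 0
  show ?case
    by (intro exI[of _ 1]) (simp add: b3_0)
next
  case (Suc n)
  then obtain m where m: "m > n" "hall_thue_pow n [0] = map b3 [0..<m]"
    by blast
  let ?v = "word_image hall_thue (map b3 [0..<m])"
  have "m < length ?v"
    using length_hall_thue_gt[of "map b3 [0..<m]"] b3_range m b3_0
    by (auto simp: image_subset_iff hd_map)
  moreover have "?v = map b3 [0..<length ?v]"
    using inf_image_prefix[of hall_thue b3 m, OF hall_thue_b3_nonempty]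
    by (simp add: b3_fixed_point)
  ultimately show ?case
    using m by (intro exI[of _ "length ?v"]) simp
qed

lemma pairs_in_b3:
  assumes "a \<in> {0, 1, 2}" "b \<in> {0, 1, 2}" "a \<noteq> b"
  shows "[a, b] \<in> factors b3"
proof -
  \<comment> \<open>The third iterate is the first to contain all six pairs: the second, 012021,
    lacks 10.\<close>
  have "hall_thue_pow 3 [0] = [0, 1, 2, 0, 2, 1, 0, 1, 2, 1, 0, 2]"
    by (simp add: numeral_eq_Suc hall_thue_def)
  then obtain m where m: "map b3 [0..<m] = [0, 1, 2, 0, 2, 1, 0, 1, 2, 1, 0, 2]"
    using hall_thue_pow_prefix_b3[of 3] by metis
  have "sublist [a, b] (map b3 [0..<m])"
    unfolding m using assms by (auto simp: sublist_code)
  then show ?thesis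
    by (rule map_upt_sublist)
qed

section \<open>Growth and locality of the iterated morphism\<close>

lemma hall_thue_pow_append: "hall_thue_pow n (u @ v) = hall_thue_pow n u @ hall_thue_pow n v"
  by (induction n arbitrary: u v) simp_all

text \<open>Presents the iterate as a single morphism, so that facts about the blocks of a morphism
  apply to it.\<close>

lemma hall_thue_pow_word_image: "hall_thue_pow n u = word_image (\<lambda>a. hall_thue_pow n [a]) u"
proof (induction u)
  case Nil
  show ?case by (induction n) simp_all
next
  case (Cons a u)
  then show ?case
    using hall_thue_pow_append[of n "[a]" u] by simp
qed

lemma hall_thue_pow_letters:
  "set u \<subseteq> {0, 1, 2} \<Longrightarrow> set (hall_thue_pow n u) \<subseteq> {0, 1, 2}"
  by (induction n) (auto simp: word_image_def hall_thue_def split: if_splits)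

text \<open>One application does not lengthen the letter \<open>2\<close>, but two do: they map 0,
  1, 2 to 012021, 0121, 02.\<close>

lemma length_hall_thue_square:
  "set u \<subseteq> {0, 1, 2} \<Longrightarrow>
     2 * length u \<le> length (word_image hall_thue (word_image hall_thue u))"
  by (induction u) (auto simp: hall_thue_def)

lemma length_hall_thue_pow:
  assumes "a \<in> {0, 1, 2}"
  shows "n < length (hall_thue_pow (2 * n) [a])"
proof (induction n)
  case (Suc n)
  have "set (hall_thue_pow (2 * n) [a]) \<subseteq> {0, 1, 2}"
    using hall_thue_pow_letters[of "[a]"] assms by simp
  from length_hall_thue_square[OF this] show ?case
    using Suc by simp
qed simp

text \<open>An occurrence of \<open>v\<close> that starts in one block and leaves it must end within
  the next, because that block is at least as long as \<open>v\<close>.\<close>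

lemma sublist_word_image_pair:
  assumes "sublist v (word_image g u)" "\<And>a. a \<in> set u \<Longrightarrow> length v \<le> length (g a)"
  shows "\<exists>u'. length u' \<le> 2 \<and> sublist u' u \<and> sublist v (word_image g u')"
  using assms
proof (induction u)
  case Nil
  then show ?case by auto
next
  case (Cons a u)
  from Cons.prems(1) consider "sublist v (g a)" | "sublist v (word_image g u)"
    | v1 v2 where "v = v1 @ v2" "suffix v1 (g a)" "prefix v2 (word_image g u)"
    by (auto simp: sublist_append)
  then show ?case
  proof cases
    case 1
    then show ?thesis
      by (intro exI[of _ "[a]"]) simp
  next
    case 2
    then obtain u' where "length u' \<le> 2" "sublist u' u" "sublist v (word_image g u')"
      using Cons by auto
    then show ?thesis
      by (auto intro: sublist_Cons_right[THEN iffD2])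
  next
    case (3 v1 v2)
    show ?thesis
    proof (cases u)
      case Nil
      then have "sublist v (g a)"
        using 3 by (auto simp: suffix_def)
      then show ?thesis
        by (intro exI[of _ "[a]"]) simp
    next
      case (Cons b u'')
      have "length v2 \<le> length (g b)"
        using Cons.prems(2)[of b] 3(1) Cons by simp
      then have "prefix v2 (g b)"
        using 3(3) Cons by (metis prefix_length_prefix prefixI word_image_Cons)
      then have "sublist v (g a @ g b)"
        using 3 by (auto simp: sublist_append)
      then show ?thesis
        using Cons by (intro exI[of _ "[a, b]"]) (auto simp: sublist_Cons_right)
    qed
  qed
qed

section \<open>Desubstitution and uniqueness\<close>

text \<open>Each round replaces \<open>M\<close> by its decoded language, which is again a Thue
  language and whose images cover \<open>M\<close>.\<close>

lemma thue_language_desubstitute: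
  assumes "thue_language L"
  shows "\<exists>M. thue_language M \<and> (\<forall>v. v \<in> L \<longleftrightarrow> (\<exists>u\<in>M. sublist v (hall_thue_pow n u)))"
proof (induction n)
  case 0
  interpret thue_language L by fact
  show ?case
    using assms factor by (intro exI[of _ L]) auto
next
  case (Suc n)
  then obtain M where M: "thue_language M"
    "\<And>v. v \<in> L \<longleftrightarrow> (\<exists>u\<in>M. sublist v (hall_thue_pow n u))"
    by blast
  interpret M: thue_language M by fact
  have mono: "sublist (hall_thue_pow n u) (hall_thue_pow n u')" if "sublist u u'" for u u'
    using that unfolding sublist_def by (metis hall_thue_pow_append)
  have step: "hall_thue_pow (Suc n) u = hall_thue_pow n (word_image hall_thue u)" for u
    by (simp add: funpow_Suc_right del: funpow.simps)
  have "v \<in> L \<longleftrightarrow> (\<exists>u\<in>M.decoded. sublist v (hall_thue_pow (Suc n) u))" for v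
    unfolding M(2) step
    using M.decoded_cover M.decoded_image mono sublist_order.order.trans by meson
  then show ?case
    using M.thue_language_decoded by blast
qed

theorem thue_language_unique:
  assumes "thue_language L"
  shows "L = factors b3"
proof (intro equalityI subsetI)
  fix v assume v: "v \<in> L"
  \<comment> \<open>Each application of the squared morphism at least doubles lengths, so every
    letter image is now longer than \<open>v\<close>, and \<open>v\<close> meets at most two of
    them.\<close>
  define n where "n = 2 * length v"
  obtain M where M: "thue_language M"
    "\<And>v. v \<in> L \<longleftrightarrow> (\<exists>u\<in>M. sublist v (hall_thue_pow n u))"
    using thue_language_desubstitute[OF assms] by blast
  interpret M: thue_language M by fact
  obtain u where u: "u \<in> M" "sublist v (word_image (\<lambda>a. hall_thue_pow n [a]) u)"
    using v M(2) hall_thue_pow_word_image[of n] by metis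
  have "length v \<le> length (hall_thue_pow n [a])" if "a \<in> set u" for a
    using length_hall_thue_pow[of a "length v"] M.letters[OF u(1)] that
    unfolding n_def by (meson less_imp_le_nat subsetD)
  then obtain u' where u': "length u' \<le> 2" "sublist u' u"
    "sublist v (word_image (\<lambda>a. hall_thue_pow n [a]) u')"
    using sublist_word_image_pair[OF u(2)] by blast
  have "u' \<in> M"
    using u u' M.factor by blast
  \<comment> \<open>By square-freeness, a two-letter \<open>u'\<close> consists of distinct letters,
    and all such pairs occur in \<open>b3\<close>.\<close>
  have "u' \<in> factors b3"
  proof -
    consider "u' = []" | a where "u' = [a]" | a b where "u' = [a, b]"
      using u'(1) by (auto simp: le_Suc_eq numeral_eq_Suc length_Suc_conv)
    then show ?thesis
    proof cases
      case 1
      then show ?thesis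
        using pairs_in_b3[of 0 1] factors_sublist by fastforce
    next
      case (2 a)
      then have "a \<in> {0, 1, 2}"
        using M.letters[OF \<open>u' \<in> M\<close>] by simp
      then have "\<exists>b\<in>{0, 1, 2}. b \<noteq> a"
        by auto
      then obtain b where "[a, b] \<in> factors b3"
        using pairs_in_b3 \<open>a \<in> {0, 1, 2}\<close> by metis
      then show ?thesis
        using 2 factors_sublist[of "[a, b]" b3 "[a]"] by (simp add: sublist_Cons_right)
    next
      case (3 a b)
      then have "a \<noteq> b"
        using \<open>u' \<in> M\<close> M.square_free[of "[a]"] by auto
      then show ?thesis
        using 3 M.letters[OF \<open>u' \<in> M\<close>] pairs_in_b3[of a b] by simp
    qed
  qed
  then have "hall_thue_pow n u' \<in> factors b3"
    by (rule hall_thue_pow_factors_b3)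
  then show "v \<in> factors b3"
    using u'(3) factors_sublist hall_thue_pow_word_image by metis
next
  fix v assume "v \<in> factors b3"
  then obtain i j where v: "v = map b3 [i..<j]"
    by (auto simp: factors_def)
  \<comment> \<open>The iterate is a prefix of \<open>b3\<close> longer than \<open>j\<close>, so it
    contains \<open>v\<close>. It remains to find the letter \<open>0\<close> in the desubstituted
    language.\<close>
  obtain m where m: "m > j" "hall_thue_pow j [0] = map b3 [0..<m]"
    using hall_thue_pow_prefix_b3 by blast
  have "sublist v (hall_thue_pow j [0])"
  proof (cases "i \<le> j")
    case True
    then have "[0..<m] = [0..<i] @ [i..<j] @ [j..<m]"
      using m(1) upt_add_eq_append[of 0 i "m - i"] upt_add_eq_append[of i j "m - j"] by simp
    then show ?thesis
      by (simp add: v m(2))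
  qed (simp add: v)
  moreover obtain M where M: "thue_language M"
    "\<And>v. v \<in> L \<longleftrightarrow> (\<exists>u\<in>M. sublist v (hall_thue_pow j u))"
    using thue_language_desubstitute[OF assms] by blast
  interpret M: thue_language M by fact
  have "[0] \<in> M"
  proof -
    obtain p q where "0 # p @ [] @ q @ [0] \<in> M"
      using M.extend_to_marker[OF M.Nil_in] by blast
    then show ?thesis
      using M.infix_in[of "[]" "[0]" "p @ q @ [0]"] by simp
  qed
  ultimately show "v \<in> L"
    using M(2) by blast
qed

section \<open>Overlap-free walks\<close>

text \<open>Two full periods plus one letter already push the exponent above 2; every overlap
  exhibited below has this form.\<close>

lemma is_overlapI: "is_overlap ((a # u) @ (a # u) @ [a])"
  unfolding is_overlap_def
  by (rule exI[of _ "a # u"], rule exI[of _ 2], rule exI[of _ "[a]"])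
    (simp add: numeral_eq_Suc field_simps)

lemma overlap_free_no_overlap:
  assumes "bi_overlap_free w"
  shows "p @ (a # u) @ (a # u) @ [a] @ q \<notin> bi_factors w"
proof
  assume "p @ (a # u) @ (a # u) @ [a] @ q \<in> bi_factors w"
  then have "(a # u) @ (a # u) @ [a] \<in> bi_factors w"
    using bi_factors_sublist[of "p @ (a # u) @ (a # u) @ [a] @ q" w]
    by (metis append.assoc sublist_appendI)
  then show False
    using is_overlapI[of a u] assms unfolding bi_overlap_free_def by (metis (no_types))
qed

text \<open>Treats both graphs at once: \<open>k4\<close> and \<open>k3\<close> differ only in the
  middle \<open>r\<close> of the image of \<open>0\<close>, which is \<open>[3]\<close> or
  empty.\<close>

locale coded_walk =
  fixes w :: "int \<Rightarrow> nat" and k :: "nat \<Rightarrow> nat list" and r :: "nat list"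
  assumes overlap_free: "bi_overlap_free w"
    and k_images: "k 0 = [1, 2] @ r @ [2]" "k 1 = [1, 2]" "k 2 = [1, 0]"
    and one_recurs: "u \<in> bi_factors w \<Longrightarrow> length u = 5 \<Longrightarrow> 1 \<in> set u"
    and one_return_words: "1 \<notin> set s \<Longrightarrow> 1 # s @ [1] \<in> bi_factors w \<Longrightarrow>
      \<exists>y. set y \<subseteq> {0, 1, 2} \<and> 1 # s = word_image k y"
begin

sublocale factor_language "bi_factors w"
  by (rule factor_language_bi_factors)

lemmas no_overlap = overlap_free_no_overlap[OF overlap_free]

text \<open>Unlike for \<open>hall_thue\<close>, every block starts with the marker, so parsing
  never has to look past the next letter.\<close>

lemma image_starts_with_one:
  "set z \<subseteq> {0, 1, 2} \<Longrightarrow> \<exists>t. word_image k z @ [1] = 1 # t"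
  using k_images by (cases z) auto

sublocale decodable_language "bi_factors w" k "{0, 1, 2}" 1 5
proof
  fix s z
  assume L: "1 # s @ word_image k z @ [1] \<in> bi_factors w" and z: "set z \<subseteq> {0, 1, 2}"
  obtain t where "word_image k z @ [1] = 1 # t"
    using image_starts_with_one[OF z] by blast
  then have "1 # s @ [1] \<in> bi_factors w"
    using L infix_in[of "[]" "1 # s @ [1]" t] by simp
  then show "\<exists>y. set y \<subseteq> {0, 1, 2} \<and> 1 # s = word_image k y"
    using parse_by_return_words[OF one_return_words] by blast
qed (rule one_recurs)

text \<open>The image of \<open>u @ u\<close> is followed by another block or by the closing marker.
  Either starts with \<open>1\<close>, as does the image of \<open>u\<close>, so the square becomes
  an overlap.\<close>

lemma decoded_no_square:
  assumes "u \<noteq> []"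
  shows "p @ u @ u @ q \<notin> decoded"
proof
  assume "p @ u @ u @ q \<in> decoded"
  then have uu: "u @ u \<in> decoded"
    using decoded_factor[of "p @ u @ u @ q" "u @ u"] by (metis append.assoc sublist_appendI)
  obtain q' where q': "set q' \<subseteq> {0, 1, 2}" "word_image k (u @ u @ q') @ [1] \<in> bi_factors w"
  proof -
    obtain p q' where "set (p @ (u @ u) @ q') \<subseteq> {0, 1, 2}"
      "word_image k (p @ (u @ u) @ q') @ [1] \<in> bi_factors w"
      using uu unfolding decoded_def by blast
    then show ?thesis
      using infix_in[of "word_image k p" "word_image k (u @ u @ q') @ [1]" "[]"]
      by (intro that) auto
  qed
  obtain a u' where u: "u = a # u'" "a \<in> {0, 1, 2}"
    using assms decoded_letters[OF uu] by (cases u) auto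
  then obtain t where t: "word_image k u = 1 # t"
    using k_images by auto
  obtain t' where t': "word_image k q' @ [1] = 1 # t'"
    using image_starts_with_one[OF q'(1)] by blast
  have "[] @ (1 # t) @ (1 # t) @ [1] @ t' \<in> bi_factors w"
    using q'(2) unfolding word_image_append append.assoc t t' by simp
  then show False
    using no_overlap by blast
qed

lemma thue_language_decoded: "thue_language decoded"
proof -
  interpret D: factor_language decoded
    by (rule factor_language_decoded)
  show ?thesis
  proof
    show "u \<in> decoded \<Longrightarrow> set u \<subseteq> {0, 1, 2}" for u
      by (rule decoded_letters)
    show "u \<noteq> [] \<Longrightarrow> u @ u \<notin> decoded" for u
      using decoded_no_square[of u "[]" "[]"] by simp
    show "[0, 1, 0] \<notin> decoded"
    proof
      assume "[0, 1, 0] \<in> decoded"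
      then have "([1, 2] @ r) @ (2 # [1]) @ (2 # [1]) @ [2] @ (r @ [2]) \<in> bi_factors w"
        using decoded_image[of "[0, 1, 0]"] by (simp add: k_images k_images(2)[simplified])
      then show False
        using no_overlap by blast
    qed
    show "[2, 1, 2] \<notin> decoded"
    proof
      assume "[2, 1, 2] \<in> decoded"
      then obtain a b where ab: "a # [2, 1, 2] @ [b] \<in> decoded"
        using D.extend by blast
      then have "a \<noteq> 2" "a \<noteq> 1" "b \<noteq> 2" "b \<noteq> 1"
        using decoded_no_square[of "[2]" "[]" "[1, 2, b]"]
          decoded_no_square[of "[1, 2]" "[]" "[b]"]
          decoded_no_square[of "[2]" "[a, 2, 1]" "[]"]
          decoded_no_square[of "[2, 1]" "[a]" "[]"]
        by auto
      then have "a = 0" "b = 0"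
        using decoded_letters[OF ab] by auto
      then have "([1, 2] @ r) @ (2 # [1, 0, 1]) @ (2 # [1, 0, 1]) @ [2] @ (r @ [2])
          \<in> bi_factors w"
        using decoded_image[OF ab] by (simp add: k_images k_images(2)[simplified])
      then show False
        using no_overlap by blast
    qed
  qed
qed

theorem bi_factors_eq: "bi_factors w = factors (inf_image k b3)"
proof -
  have "k (b3 i) \<noteq> []" for i
  proof -
    have "b3 i \<in> {0, 1, 2}"
      using b3_range by blast
    then have "k (b3 i) \<in> k ` {0, 1, 2}"
      by (rule imageI)
    then show ?thesis
      unfolding image_insert k_images by auto
  qed
  from factors_inf_image[of k b3, OF this] show ?thesis
    using decoded_language unfolding thue_language_unique[OF thue_language_decoded]
    by (rule trans[OF _ sym, rotated])
qed

end

section \<open>The two graphs\<close>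

lemma P4_edges_at_1:
    "{1, a} \<in> P4_edges \<longleftrightarrow> a = 0 \<or> a = 2"
    "{a, 1} \<in> P4_edges \<longleftrightarrow> a = 0 \<or> a = 2"
  and P4_edges_off_1:
    "a \<noteq> 1 \<Longrightarrow> b \<noteq> 1 \<Longrightarrow> {a, b} \<in> P4_edges \<longleftrightarrow> a = 2 \<and> b = 3 \<or> a = 3 \<and> b = 2"
  by (auto simp: P4_edges_def doubleton_eq_iff)

lemma P3_star_edge_iff:
  "{a, b} \<in> P3_star_edges \<longleftrightarrow> (a, b) \<in> {(0, 1), (1, 0), (1, 2), (2, 1), (2, 2)}"
  by (auto simp: P3_star_edges_def doubleton_eq_iff)

lemma bi_walk_successively:
  assumes "bi_walk V E w"
  shows "u \<in> bi_factors w \<Longrightarrow> successively (\<lambda>a b. {a, b} \<in> E) u"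
proof (induction u)
  case (Cons a u)
  have "u \<in> bi_factors w"
    using bi_factors_sublist[OF Cons.prems, of u] by (simp add: sublist_Cons_right)
  moreover have "{a, b} \<in> E" if "u = b # v" for b v
  proof -
    have "[a, b] \<in> bi_factors w"
      using bi_factors_sublist[OF Cons.prems, of "[a, b]"] that by (simp add: sublist_Cons_right)
    then show ?thesis
      using assms bi_factors_pair unfolding bi_walk_def by metis
  qed
  ultimately show ?case
    using Cons.IH by (cases u) auto
qed simp

lemma list_length_less_5_cases:
  assumes "length s < 5"
  obtains "s = []" | a where "s = [a]" | a b where "s = [a, b]"
    | a b c where "s = [a, b, c]" | a b c d where "s = [a, b, c, d]"
  using assms by (auto simp: less_Suc_eq numeral_eq_Suc length_Suc_conv)

text \<open>Deleting \<open>1\<close> isolates \<open>0\<close> and leaves the edge between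
  \<open>2\<close> and \<open>3\<close>. Five letters without \<open>1\<close> thus form 23232 or
  32323, both overlaps. Between consecutive \<open>1\<close>s the walk reads 0, 2 or 232; lengths 2
  and 4 fail by parity.\<close>

lemma P4_coded_walk:
  assumes walk: "bi_walk P4_verts P4_edges w" and free: "bi_overlap_free w"
  shows "coded_walk w k4 [3]"
proof
  interpret factor_language "bi_factors w"
    by (rule factor_language_bi_factors)
  note edges = bi_walk_successively[OF walk]
  show recurs: "1 \<in> set u" if u: "u \<in> bi_factors w" "length u = 5" for u
  proof (rule ccontr)
    assume 1: "1 \<notin> set u"
    obtain a b c d e where abc: "u = [a, b, c, d, e]"
      using u(2) by (auto simp: numeral_eq_Suc length_Suc_conv)
    have "u = [2, 3, 2, 3, 2] \<or> u = [3, 2, 3, 2, 3]"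
      using edges[OF u(1)] 1 by (auto simp: abc P4_edges_off_1 simp del: One_nat_def)
    then show False
      using u(1) overlap_free_no_overlap[OF free, of "[]" 2 "[3]" "[]"]
        overlap_free_no_overlap[OF free, of "[]" 3 "[2]" "[]"] by auto
  qed
  show "\<exists>y. set y \<subseteq> {0, 1, 2} \<and> 1 # s = word_image k4 y"
    if s: "1 \<notin> set s" "1 # s @ [1] \<in> bi_factors w" for s
  proof -
    have "length s < 5"
      using marker_free_length[of 5 1 s "[1]" "[1]"] recurs s by simp
    then have "s = [0] \<or> s = [2] \<or> s = [2, 3, 2]"
    proof (rule list_length_less_5_cases)
      note [simp] = P4_edges_at_1 P4_edges_off_1 and [simp del] = One_nat_def
      note facts = edges[OF s(2)] s(1)
      show ?thesis if "s = []"
        using facts by (simp add: that)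
      show ?thesis if "s = [a]" for a
        using facts by (simp add: that)
      show ?thesis if "s = [a, b]" for a b
        using facts by (simp add: that) linarith
      show ?thesis if "s = [a, b, c]" for a b c
        using facts by (simp add: that) linarith
      show ?thesis if "s = [a, b, c, d]" for a b c d
        using facts by (simp add: that) linarith
    qed
    then have "1 # s \<in> word_image k4 ` {[0], [1], [2]}"
      by (auto simp: k4_def)
    then show ?thesis
      by (elim imageE) (intro exI conjI, auto)
  qed
qed (simp_all add: free k4_def)

text \<open>Deleting \<open>1\<close> isolates \<open>0\<close> and leaves the loop at
  \<open>2\<close>. Since 222 is an overlap, the walk reads 0, 2 or 22 between consecutive
  \<open>1\<close>s.\<close>

lemma P3_star_coded_walk:
  assumes walk: "bi_walk P3_star_verts P3_star_edges w" and free: "bi_overlap_free w"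
  shows "coded_walk w k3 []"
proof
  interpret factor_language "bi_factors w"
    by (rule factor_language_bi_factors)
  note edges = bi_walk_successively[OF walk]
  have no_222: "p @ [2, 2, 2] @ q \<notin> bi_factors w" for p q
    using overlap_free_no_overlap[OF free, of p 2 "[]" q] by simp
  show recurs: "1 \<in> set u" if u: "u \<in> bi_factors w" "length u = 5" for u
  proof (rule ccontr)
    assume 1: "1 \<notin> set u"
    obtain a b c d e where abc: "u = [a, b, c, d, e]"
      using u(2) by (auto simp: numeral_eq_Suc length_Suc_conv)
    have "u = [2, 2, 2, 2, 2]"
      using edges[OF u(1)] 1 by (auto simp: abc P3_star_edge_iff)
    then show False
      using u(1) no_222[of "[]" "[2, 2]"] by simp
  qed
  show "\<exists>y. set y \<subseteq> {0, 1, 2} \<and> 1 # s = word_image k3 y"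
    if s: "1 \<notin> set s" "1 # s @ [1] \<in> bi_factors w" for s
  proof -
    have "length s < 5"
      using marker_free_length[of 5 1 s "[1]" "[1]"] recurs s by simp
    then have "s \<in> {[0], [2], [2, 2], [2, 2, 2], [2, 2, 2, 2]}"
      by (rule list_length_less_5_cases)
        (use edges[OF s(2)] s(1) in \<open>auto simp: P3_star_edge_iff\<close>)
    moreover have "s \<noteq> [2, 2, 2]" "s \<noteq> [2, 2, 2, 2]"
      using s(2) no_222[of "[1]" "[1]"] no_222[of "[1]" "[2, 1]"] by auto
    ultimately have "1 # s \<in> word_image k3 ` {[0], [1], [2]}"
      by (auto simp: k3_def)
    then show ?thesis
      by (elim imageE) (intro exI conjI, auto)
  qed
qed (simp_all add: free k3_def)

theorem theorem7:
  shows "(\<forall>w. bi_walk P4_verts P4_edges w \<and> bi_overlap_free w \<longrightarrow>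
            bi_factors w = factors (inf_image k4 b3)) \<and>
         (\<forall>w. bi_walk P3_star_verts P3_star_edges w \<and> bi_overlap_free w \<longrightarrow>
            bi_factors w = factors (inf_image k3 b3))"
  by (simp add: P4_coded_walk[THEN coded_walk.bi_factors_eq]
      P3_star_coded_walk[THEN coded_walk.bi_factors_eq])

end
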